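(* There is no finite non-commutative ring $R$ with non-commutative subrings $S, K$ such that $S \subseteq K$ and $|C_K(S)| = 1$ satisfying $$2|K|\Pr(S,K) - |S|\Pr(S) = -\frac{2|K|}{|S|} + \frac{4}{|S|} + 2|K| - |S|.$$ In particular, there is no finite non-commutative ring $R$ with trivial center (that is, $Z(R) = \{0\}$) having commuting probability $\Pr(R) = 1 - \frac{2}{|R|} + \frac{4}{|R|^2}$.
   Context: Rings are associative and not assumed to have a unity. $Z(R)$ is the center of $R$. For subrings $S \subseteq K$ of a finite ring, $C_K(S) = \{k \in K : ks = sk \ \forall s \in S\}$. For subrings $S, K$, $\Pr(S,K) = \frac{|\{(s,k) \in S \times K : sk = ks\}|}{|S||K|}$; $\Pr(S) = \Pr(S,S)$ and $\Pr(R) = \Pr(R,R)$. *)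

theory Defs
  imports Complex_Main
begin

text \<open>The type class \<^class>\<open>ring\<close> is that of associative rings not assumed to have a unity;
  accordingly, subrings are not required to contain one.\<close>

definition is_subring :: "'a::ring set \<Rightarrow> bool" where
  "is_subring S \<longleftrightarrow>
     0 \<in> S \<and> (\<forall>x\<in>S. \<forall>y\<in>S. x - y \<in> S) \<and> (\<forall>x\<in>S. \<forall>y\<in>S. x * y \<in> S)"

definition noncommutative :: "'a::ring set \<Rightarrow> bool" where
  "noncommutative S \<longleftrightarrow> (\<exists>x\<in>S. \<exists>y\<in>S. x * y \<noteq> y * x)"

definition centralizer :: "'a::ring set \<Rightarrow> 'a set \<Rightarrow> 'a set" where
  "centralizer K S = {k \<in> K. \<forall>s\<in>S. k * s = s * k}"

definition center :: "'a::ring set \<Rightarrow> 'a set" where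
  "center R = {z \<in> R. \<forall>r\<in>R. z * r = r * z}"

definition commuting_prob :: "'a::ring set \<Rightarrow> 'a set \<Rightarrow> real" where
  "commuting_prob S K =
     real (card {(s, k). s \<in> S \<and> k \<in> K \<and> s * k = k * s}) / (real (card S) * real (card K))"

end

theory Submission
  imports Defs
begin

text \<open>Counting the edges of the non-commuting graph between \<open>S\<close> and \<open>K\<close>, the equation says that
  there are exactly \<open>|K| - 2\<close> of them. As \<open>C\<^sub>K(S)\<close> is trivial, each nonzero vertex is
  non-central, so its commuting neighbours form a proper additive subgroup, of index at least 2.
  The degrees are thus at least \<open>|K|/2\<close> on \<open>S\<close> and \<open>|S|/2\<close> on \<open>K - S\<close>, which is too many edges
  as soon as \<open>|S| \<ge> 3\<close>.\<close>

text \<open>For g in \<open>G - H\<close>, the translate g + H lies in G and misses H, since (g + h)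
  - h = g. It has the size of H, so two disjoint copies fit into G.\<close>

lemma card_proper_subgroup_le:
  fixes H G :: "'a::group_add set"
  assumes "finite G" "H \<subset> G"
    and diffH: "\<And>x y. x \<in> H \<Longrightarrow> y \<in> H \<Longrightarrow> x - y \<in> H"
    and addG: "\<And>x y. x \<in> G \<Longrightarrow> y \<in> G \<Longrightarrow> x + y \<in> G"
  shows "2 * card H \<le> card G"
proof -
  obtain g where g: "g \<in> G" "g \<notin> H" using assms(2) by blast
  have "g + h \<in> G - H" if "h \<in> H" for h
    using g that addG[of g h] diffH[of "g + h" h] assms(2) by auto
  hence "(+) g ` H \<subseteq> G - H" by blast
  hence "card ((+) g ` H) \<le> card (G - H)" using assms(1) by (intro card_mono) auto
  moreover have "card ((+) g ` H) = card H" by (rule card_image) simp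
  moreover have "card (G - H) = card G - card H"
    using assms by (intro card_Diff_subset) (auto intro: finite_subset)
  ultimately show ?thesis using card_mono[OF assms(1), of H] assms(2) by auto
qed

lemma is_subring_add:
  assumes "is_subring S" "x \<in> S" "y \<in> S"
  shows "x + y \<in> S"
proof -
  have "0 - y \<in> S" using assms unfolding is_subring_def by blast
  hence "x - (0 - y) \<in> S" using assms unfolding is_subring_def by blast
  thus ?thesis by simp
qed

text \<open>The centralizer of x in K is the kernel of the additive map k \<mapsto> k * x - x * k on
  K, and t witnesses that it is proper.\<close>

lemma card_centralizer_singleton_le:
  fixes K :: "'a::{ring, finite} set"
  assumes "is_subring K" "t \<in> K" "t * x \<noteq> x * t"
  shows "2 * card (centralizer K {x}) \<le> card K"
proof (rule card_proper_subgroup_le)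
  show "centralizer K {x} \<subset> K" using assms(2,3) unfolding centralizer_def by auto
  show "a - b \<in> centralizer K {x}" if "a \<in> centralizer K {x}" "b \<in> centralizer K {x}" for a b
    using that assms(1) unfolding centralizer_def is_subring_def by (auto simp: algebra_simps)
qed (use assms(1) is_subring_add in auto)

lemma card_commuting_pairs:
  fixes X Y :: "'a::{ring, finite} set"
  shows "card {(x, y). x \<in> X \<and> y \<in> Y \<and> x * y = y * x} = (\<Sum>x\<in>X. card (centralizer Y {x}))"
proof -
  have "{(x, y). x \<in> X \<and> y \<in> Y \<and> x * y = y * x} = (SIGMA x:X. centralizer Y {x})"
    by (auto simp: centralizer_def)
  thus ?thesis by simp
qed

text \<open>Double counting of commuting pairs: summing the constant 1 over restricted index sets
  gives the cardinalities.\<close>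

lemma sum_centralizer_swap:
  fixes X Y :: "'a::{ring, finite} set"
  shows "(\<Sum>x\<in>X. card (centralizer Y {x})) = (\<Sum>y\<in>Y. card (centralizer X {y}))"
  using sum.swap_restrict[of X Y "\<lambda>_ _. 1::nat" "\<lambda>x y. y * x = x * y"]
  by (simp add: centralizer_def eq_commute)

text \<open>A non-commuting pair consists of two distinct nonzero elements, because 0 and equal
  elements commute.\<close>

lemma card_noncommutative_ge_3:
  fixes S :: "'a::{ring, finite} set"
  assumes "is_subring S" "noncommutative S"
  shows "3 \<le> card S"
proof -
  obtain x y where xy: "x \<in> S" "y \<in> S" "x * y \<noteq> y * x"
    using assms(2) unfolding noncommutative_def by blast
  hence "x \<noteq> 0" "y \<noteq> 0" "x \<noteq> y" by auto
  hence "card {0, x, y} = 3" by simp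
  moreover have "{0, x, y} \<subseteq> S" using xy assms(1) unfolding is_subring_def by auto
  ultimately show ?thesis by (metis card_mono finite)
qed

lemma commuting_prob_equation_impossible:
  fixes S K :: "'a::{ring, finite} set"
  assumes S: "is_subring S" and K: "is_subring K" and nc: "noncommutative S"
    and sub: "S \<subseteq> K" and triv: "card (centralizer K S) = 1"
    and eq: "2 * real (card K) * commuting_prob S K - real (card S) * commuting_prob S S
             = - (2 * real (card K) / real (card S)) + 4 / real (card S)
               + 2 * real (card K) - real (card S)"
  shows False
proof -
  define m where "m = real (card S)"
  define n where "n = real (card K)"
  define A where "A = real (\<Sum>s\<in>S. card (centralizer K {s}))"
  define B where "B = real (\<Sum>s\<in>S. card (centralizer S {s}))"
  define D where "D = real (\<Sum>k\<in>K - S. card (centralizer S {k}))"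
  have m3: "3 \<le> m" using card_noncommutative_ge_3[OF S nc] by (simp add: m_def)
  have mn: "m \<le> n" using sub by (simp add: m_def n_def card_mono)
  have zero: "0 \<in> S" "0 \<in> centralizer K S"
    using S K unfolding is_subring_def centralizer_def by auto
  \<comment> \<open>The witness lies in S, hence also in K, so this fact serves both degree
    bounds.\<close>
  have noncentral: "\<exists>s\<in>S. s * k \<noteq> k * s" if "k \<in> K" "k \<noteq> 0" for k
  proof -
    have "centralizer K S = {0}" using triv zero by (auto simp: card_1_singleton_iff)
    thus ?thesis using that by (auto simp: centralizer_def)
  qed

  have "commuting_prob S K = A / (m * n)" "commuting_prob S S = B / (m * m)"
    unfolding commuting_prob_def card_commuting_pairs A_def B_def m_def n_def by simp_all
  with eq have "2 * n * (A / (m * n)) - m * (B / (m * m)) = - (2 * n / m) + 4 / m + 2 * n - m"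
    by (simp add: m_def n_def)
  \<comment> \<open>Equivalently (m * n - A) - (m * m - B) / 2 = n - 2: ordered non-commuting pairs
    in S \<times> K, where edges inside S were counted twice.\<close>
  hence edges: "2 * A - B = - 2 * n + 4 + 2 * (m * n) - m * m"
    using m3 mn by (simp add: field_simps)

  \<comment> \<open>Splitting K into S and \<open>K - S\<close> turns 2 * A - B into A + D, so upper
    bounds on A and D suffice.\<close>
  have "A = real (\<Sum>k\<in>K. card (centralizer S {k}))"
    unfolding A_def by (subst sum_centralizer_swap) simp
  also have "\<dots> = D + B"
    unfolding B_def D_def using sum.subset_diff[OF sub, of "\<lambda>k. card (centralizer S {k})"] by simp
  finally have AD: "A = D + B" .

  \<comment> \<open>The vertex 0 commutes with all of K, so it is split off and contributes
    n.\<close>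
  have "A = n + real (\<Sum>s\<in>S - {0}. card (centralizer K {s}))"
    unfolding A_def n_def using zero(1)
    by (subst sum.remove[of _ 0]) (auto simp: centralizer_def)
  moreover have "real (\<Sum>s\<in>S - {0}. card (centralizer K {s})) \<le> (\<Sum>s\<in>S - {0}. n / 2)"
    unfolding of_nat_sum
  proof (rule sum_mono)
    fix s assume "s \<in> S - {0}"
    with noncentral sub obtain t where "t \<in> K" "t * s \<noteq> s * t" by blast
    from card_centralizer_singleton_le[OF K this]
    show "real (card (centralizer K {s})) \<le> n / 2" by (simp add: n_def)
  qed
  moreover have "real (card (S - {0})) = m - 1"
    using zero(1) m3 by (simp add: m_def card_Diff_singleton of_nat_diff)
  ultimately have Ale: "2 * A \<le> 2 * n + m * n - n" by (simp add: field_simps)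

  \<comment> \<open>Elements outside S are nonzero, so here the half bound holds without
    exception.\<close>
  have "D \<le> (\<Sum>k\<in>K - S. m / 2)"
    unfolding D_def of_nat_sum
  proof (rule sum_mono)
    fix k assume "k \<in> K - S"
    with noncentral zero(1) obtain t where "t \<in> S" "t * k \<noteq> k * t" by blast
    from card_centralizer_singleton_le[OF S this]
    show "real (card (centralizer S {k})) \<le> m / 2" by (simp add: m_def)
  qed
  moreover have "real (card (K - S)) = n - m"
    using sub by (simp add: m_def n_def card_Diff_subset card_mono of_nat_diff)
  ultimately have Dle: "2 * D \<le> m * n - m * m" by (simp add: field_simps)

  have "8 + 2 * (m * n) \<le> m * m + 5 * n" using edges AD Ale Dle by linarith
  \<comment> \<open>This eliminates n and leaves m * m - 5 * m + 8 \<le> 0, whereas completing the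
    square shows that the left side is at least 7/4.\<close>
  moreover have "(n - m) * (2 * m - 5) \<ge> 0" using mn m3 by (intro mult_nonneg_nonneg) auto
  moreover have "(m - 5 / 2) * (m - 5 / 2) \<ge> 0" by simp
  ultimately show False by (simp add: algebra_simps)
qed

theorem proposition4p10:
  shows "\<not> (noncommutative (UNIV :: 'a::{ring, finite} set) \<and>
            (\<exists>S K :: 'a set.
               is_subring S \<and> is_subring K \<and> noncommutative S \<and> noncommutative K \<and>
               S \<subseteq> K \<and> card (centralizer K S) = 1 \<and>
               2 * real (card K) * commuting_prob S K - real (card S) * commuting_prob S S
                 = - (2 * real (card K) / real (card S)) + 4 / real (card S)
                   + 2 * real (card K) - real (card S)))
       \<and> \<not> (noncommutative (UNIV :: 'a set) \<and> center (UNIV :: 'a set) = {0} \<and>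
            commuting_prob (UNIV :: 'a set) UNIV
              = 1 - 2 / real (card (UNIV :: 'a set)) + 4 / (real (card (UNIV :: 'a set)))\<^sup>2)"
proof (intro conjI notI)
  assume "noncommutative (UNIV :: 'a set) \<and>
            (\<exists>S K :: 'a set.
               is_subring S \<and> is_subring K \<and> noncommutative S \<and> noncommutative K \<and>
               S \<subseteq> K \<and> card (centralizer K S) = 1 \<and>
               2 * real (card K) * commuting_prob S K - real (card S) * commuting_prob S S
                 = - (2 * real (card K) / real (card S)) + 4 / real (card S)
                   + 2 * real (card K) - real (card S))"
  thus False using commuting_prob_equation_impossible by blast
next
  assume H: "noncommutative (UNIV :: 'a set) \<and> center (UNIV :: 'a set) = {0} \<and>
            commuting_prob (UNIV :: 'a set) UNIV
              = 1 - 2 / real (card (UNIV :: 'a set)) + 4 / (real (card (UNIV :: 'a set)))\<^sup>2"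
  let ?n = "real (card (UNIV :: 'a set))" and ?P = "commuting_prob (UNIV :: 'a set) UNIV"
  \<comment> \<open>For S = K = \<open>UNIV\<close> the equation says that n times the probability
    is n - 2 + 4 / n. The quotient 2 * n / n stays uncancelled to match the form of the general
    equation.\<close>
  have arith: "2 * n * (1 - 2 / n + 4 / n\<^sup>2) - n * (1 - 2 / n + 4 / n\<^sup>2)
      = - (2 * n / n) + 4 / n + 2 * n - n" if "n > 0" for n :: real
    using that by (simp add: field_simps power2_eq_square)
  have "?n > 0" by (simp add: card_gt_0_iff)
  from arith[OF this] have "2 * ?n * ?P - ?n * ?P = - (2 * ?n / ?n) + 4 / ?n + 2 * ?n - ?n"
    using H by (simp only:)
  moreover have "centralizer (UNIV :: 'a set) UNIV = {0}"
    using H by (simp add: centralizer_def center_def)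
  ultimately show False
    using H commuting_prob_equation_impossible[of "UNIV :: 'a set" UNIV]
    by (simp add: is_subring_def)
qed

end
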